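(* Let $\mathscr{M}^{1\times},\mathscr{M}^{2\times}$ be the constrained product MDPs of two agents with independent transitions and common horizon $H^\times=H+1$, let $r^\times_h(s^1,s^2,a^1,a^2)$ be their joint objective reward, and let $\delta^1,\delta^2\in\mathbb{R}$. Let $X$ (respectively $Y$) be the set of occupancy measures $x$ of $\mathscr{M^{1\times}}$ with total constraint reward at least $1-\delta^1$ (respectively $y$ of $\mathscr{M}^{2\times}$ with total constraint reward at least $1-\delta^2$), and let $$g(x,y)=\sum_{h=1}^{H^\times}\ \sum_{s^1\in S^{1\times},\,a^1\in A^{1}}\ \sum_{s^2\in S^{2\times},\,a^2\in A^{2}} r^\times_h(s^1,s^2,a^1,a^2)\,x_h(s^1,a^1)\,y_h(s^2,a^2).$$ Let $x^*$ be an optimal solution of $\max_{x\in X}\min_{y\in Y} g(x,y)$, with optimal value $v_x^*$, and let $\pi^{1*}$ be a policy for $\mathscr{M}^{1\times}$ induced by $x^*$. Let $y^*$ be an optimal solution of $\max_{y\in Y}\min_{x\in X} g(x,y)$, with optimal value $v_y^*$, and let $\pi^{2*}$ be a policy for $\mathscr{M}^{2\times}$ induced by $y^*$. Then each of $v_x^*$ and $v_y^*$ is a lower bound on the joint reward achieved when executing $\pi=(\pi^{1*},\pi^{2*})$, i.e. $$v_x^*\le \mathbb{E}_{\pi}\Big[\sum_{h=1}^{H^\times} r^\times_h(s^1_h,s^2_h,a^1_h,a^2_h)\Big]\quad\text{and}\quad v_y^*\le \mathbb{E}_{\pi}\Big[\sum_{h=1}^{H^\times} r^\times_h(s^1_h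,s^2_h,a^1_h,a^2_h)\Big].$$
   Context: **Agents.** For $i\in\{1,2\}$, $\mathscr{M}^i=(S^i,A^i,H,s^i_1,P^i,AP^i,L^i)$ is a labeled finite-horizon MDP: finite state set $S^i$ and action set $A^i$, horizon $H\ge 1$, initial state $s^i_1$, transition probabilities $P^i_h(s'|s,a)$ for $h\in\{1,\dots,H\}$, finite set $AP^i$ of atomic propositions, labeling $L^i:S^i\to 2^{AP^i}$. The sets $AP^1,AP^2$ are disjoint. A joint reward $r^J_h:(S^1\times S^2)\times(A^1\times A^2)\to\mathbb{R}$ is given for $h\in\{1,\dots,H\}$. Each agent has a DFA $\mathscr{A}^i=(Q^i,2^{AP^i},q^i_0,\delta_{\mathscr{A}^i},F^i)$ equivalent to its finite linear temporal logic specification $\varphi^i$ (i.e. accepting exactly the words satisfying $\varphi^i$). **Constrained product MDP.** $\mathscr{M}^{i\times}$ has state space $S^{i\times}=S^i\times Q^i$, action set $A^{i\times}=A^i$, horizon $H^\times=H+1$, initial state $s^{i\times}_1=(s^i_1,q^i_0)$, and, for $h\in\{1,\dots,H\}$, transitions $P^{i\times}_h((s',q')|(s,q),a)=P^i_h(s'|s,a)$ if $q'=\delta_{\mathscr{A}^i}(q,L^i(s))$ and $0$ otherwise. Its constraint reward is $c^{i\times}_h((s,q),a)=1$ if $h=H+1$ and $q\in F^i$, and $0$ otherwise. The joint objective reward on product states is $r^\times_h((s^1,q^1),(s^2,q^2),a^1,a^2)=r^J_h((s^1,s^2),(a^1,a^2))$ for $h\in\{1,\dots,H\}$ and $0$ for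 $h=H+1$. **Occupancy measures.** An occupancy measure of $\mathscr{M}^{i\times}$ is a family of reals $q_h(s,a)$, $h\in\{1,\dots,H^\times\}$, $s\in S^{i\times}$, $a\in A^{i}$, such that $q_h(s,a)\ge 0$; $\sum_a q_1(s,a)$ equals $1$ if $s=s^{i\times}_1$ and $0$ otherwise; and for all $s$ and all $h\in\{2,\dots,H^\times\}$, $\sum_a q_h(s,a)=\sum_{s',a'}P^{i\times}_{h-1}(s|s',a')\,q_{h-1}(s',a')$. Its total constraint reward is $\sum_{h,s,a}c^{i\times}_h(s,a)q_h(s,a)$. **Induced policy.** A policy $\pi$ for $\mathscr{M}^{i\times}$, i.e. a family of maps $\pi_h$, $h\in\{1,\dots,H^\times\}$, from $S^{i\times}$ to probability distributions on $A^{i}$, is induced by an occupancy measure $q$ if $\pi_h(a|s)=q_h(s,a)/\sum_b q_h(s,b)$ for all $(s,a,h)$ with $\sum_b q_h(s,b)>0$ (arbitrary where the denominator vanishes). **Joint execution.** Under $\pi=(\pi^{1*},\pi^{2*})$ each agent $i$ starts in $s^{i\times}_1$ and applies $\pi^{i*}$ to its own product state; action randomizations and transitions of the two agents are independent, so the two trajectories $(s^1_h,a^1_h)_h$ and $(s^2_h,a^2_h)_h$ (with $s^i_h\in S^{i\times}$) are independent. $\mathbb{E}_\pi$ denotes expectation under this joint process. *)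

theory Defs
  imports "HOL-Probability.Probability_Mass_Function"
begin

text \<open>
  State, action and automaton state sets are finite types.  Time starts at 1: families indexed by
  times are functions on \<open>nat\<close> whose values outside the intended range are irrelevant.  In particular
  a labeled MDP of horizon \<open>H\<close> carries transitions for all of \<open>{1..H}\<close>, the last one only being
  used by its product, which has horizon \<open>H + 1\<close> and is itself never run beyond that time.
\<close>

record ('s, 'a) mdp =
  horizon :: nat
  initial :: 's
  trans :: "nat \<Rightarrow> 's \<Rightarrow> 'a \<Rightarrow> 's pmf"

record ('s, 'a, 'p) lmdp = "('s, 'a) mdp" +
  props :: "'p set"
  label :: "'s \<Rightarrow> 'p set"

record ('s, 'a) cmdp = "('s, 'a) mdp" +
  creward :: "nat \<Rightarrow> 's \<Rightarrow> 'a \<Rightarrow> real"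

definition labeled_mdp :: "('s::finite, 'a::finite, 'p) lmdp \<Rightarrow> bool" where
  "labeled_mdp M \<longleftrightarrow> horizon M \<ge> 1 \<and> finite (props M) \<and> (\<forall>s. label M s \<subseteq> props M)"


text \<open>Linear temporal logic on finite words (strong next), and deterministic automata.\<close>

datatype (atoms: 'p) ltlf =
    TrueF
  | Atom 'p
  | NotF "'p ltlf"
  | AndF "'p ltlf" "'p ltlf"
  | NextF "'p ltlf"
  | UntilF "'p ltlf" "'p ltlf"

primrec ltlf_sat :: "'p set list \<Rightarrow> nat \<Rightarrow> 'p ltlf \<Rightarrow> bool" where
  "ltlf_sat w i TrueF \<longleftrightarrow> True"
| "ltlf_sat w i (Atom p) \<longleftrightarrow> p \<in> w ! i"
| "ltlf_sat w i (NotF \<phi>) \<longleftrightarrow> \<not> ltlf_sat w i \<phi>"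
| "ltlf_sat w i (AndF \<phi> \<psi>) \<longleftrightarrow> ltlf_sat w i \<phi> \<and> ltlf_sat w i \<psi>"
| "ltlf_sat w i (NextF \<phi>) \<longleftrightarrow> Suc i < length w \<and> ltlf_sat w (Suc i) \<phi>"
| "ltlf_sat w i (UntilF \<phi> \<psi>) \<longleftrightarrow>
     (\<exists>k. i \<le> k \<and> k < length w \<and> ltlf_sat w k \<psi> \<and> (\<forall>j. i \<le> j \<and> j < k \<longrightarrow> ltlf_sat w j \<phi>))"

record ('q, 'p) dfa =
  dfa_init :: 'q
  dfa_step :: "'q \<Rightarrow> 'p set \<Rightarrow> 'q"
  dfa_final :: "'q set"

definition dfa_accepts :: "('q::finite, 'p) dfa \<Rightarrow> 'p set list \<Rightarrow> bool" where
  "dfa_accepts \<A> w \<longleftrightarrow> foldl (dfa_step \<A>) (dfa_init \<A>) w \<in> dfa_final \<A>"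

text \<open>
  The alphabet is the powerset of \<open>AP\<close>.  Formulas are interpreted on nonempty words, so
  nothing is required of the automaton on the empty word.
\<close>

definition dfa_equivalent :: "'p set \<Rightarrow> ('q::finite, 'p) dfa \<Rightarrow> 'p ltlf \<Rightarrow> bool" where
  "dfa_equivalent AP \<A> \<phi> \<longleftrightarrow> atoms \<phi> \<subseteq> AP \<and>
     (\<forall>w. w \<noteq> [] \<and> set w \<subseteq> Pow AP \<longrightarrow> (dfa_accepts \<A> w \<longleftrightarrow> ltlf_sat w 0 \<phi>))"


definition product_mdp ::
  "('s::finite, 'a::finite, 'p) lmdp \<Rightarrow> ('q::finite, 'p) dfa \<Rightarrow> ('s \<times> 'q, 'a) cmdp" where
  "product_mdp M \<A> =
    \<lparr> horizon = horizon M + 1,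
      initial = (initial M, dfa_init \<A>),
      trans = (\<lambda>h (s, q) a. map_pmf (\<lambda>s'. (s', dfa_step \<A> q (label M s))) (trans M h s a)),
      creward = (\<lambda>h (s, q) a. if h = horizon M + 1 \<and> q \<in> dfa_final \<A> then 1 else 0) \<rparr>"

lemma pmf_trans_product_mdp:
  "pmf (trans (product_mdp M \<A>) h (s, q) a) (s', q') =
     (if q' = dfa_step \<A> q (label M s) then pmf (trans M h s a) s' else 0)"
proof (cases "q' = dfa_step \<A> q (label M s)")
  case True
  have "inj (\<lambda>s'. (s', dfa_step \<A> q (label M s)))"
    by (auto intro: injI)
  from pmf_map_inj'[OF this, of "trans M h s a" s'] True show ?thesis
    by (simp add: product_mdp_def)
next
  case False
  then show ?thesis
    by (auto simp: product_mdp_def pmf_eq_0_set_pmf)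
qed

definition product_reward ::
  "nat \<Rightarrow> (nat \<Rightarrow> 's1 \<times> 's2 \<Rightarrow> 'a1 \<times> 'a2 \<Rightarrow> real) \<Rightarrow>
   nat \<Rightarrow> 's1 \<times> 'q1 \<Rightarrow> 's2 \<times> 'q2 \<Rightarrow> 'a1 \<Rightarrow> 'a2 \<Rightarrow> real" where
  "product_reward H rJ h z1 z2 a1 a2 =
     (if h \<in> {1..H} then rJ h (fst z1, fst z2) (a1, a2) else 0)"


definition occupancy_measure ::
  "('s::finite, 'a::finite, 'm) mdp_scheme \<Rightarrow> (nat \<Rightarrow> 's \<Rightarrow> 'a \<Rightarrow> real) \<Rightarrow> bool" where
  "occupancy_measure M q \<longleftrightarrow>
     (\<forall>h\<in>{1..horizon M}. \<forall>s a. q h s a \<ge> 0) \<and>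
     (\<forall>s. (\<Sum>a\<in>UNIV. q 1 s a) = (if s = initial M then 1 else 0)) \<and>
     (\<forall>h\<in>{2..horizon M}. \<forall>s.
        (\<Sum>a\<in>UNIV. q h s a) =
        (\<Sum>s'\<in>UNIV. \<Sum>a'\<in>UNIV. pmf (trans M (h - 1) s' a') s * q (h - 1) s' a'))"

definition total_creward ::
  "('s::finite, 'a::finite) cmdp \<Rightarrow> (nat \<Rightarrow> 's \<Rightarrow> 'a \<Rightarrow> real) \<Rightarrow> real" where
  "total_creward M q =
     (\<Sum>h=1..horizon M. \<Sum>s\<in>UNIV. \<Sum>a\<in>UNIV. creward M h s a * q h s a)"

definition feasible_occupancies ::
  "('s::finite, 'a::finite) cmdp \<Rightarrow> real \<Rightarrow> (nat \<Rightarrow> 's \<Rightarrow> 'a \<Rightarrow> real) set" where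
  "feasible_occupancies M \<delta> = {q. occupancy_measure M q \<and> total_creward M q \<ge> 1 - \<delta>}"

definition occupancy_value ::
  "nat \<Rightarrow> (nat \<Rightarrow> 's1::finite \<Rightarrow> 's2::finite \<Rightarrow> 'a1::finite \<Rightarrow> 'a2::finite \<Rightarrow> real) \<Rightarrow>
   (nat \<Rightarrow> 's1 \<Rightarrow> 'a1 \<Rightarrow> real) \<Rightarrow> (nat \<Rightarrow> 's2 \<Rightarrow> 'a2 \<Rightarrow> real) \<Rightarrow> real" where
  "occupancy_value K r x y =
     (\<Sum>h=1..K. \<Sum>s1\<in>UNIV. \<Sum>a1\<in>UNIV. \<Sum>s2\<in>UNIV. \<Sum>a2\<in>UNIV.
        r h s1 s2 a1 a2 * x h s1 a1 * y h s2 a2)"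


text \<open>
  Minimum and maximum of possibly infinite sets of reals, as attained bounds.  In the application
  the inner minimum exists for every \<open>x'\<close>: a continuous function on a nonempty compact polytope.
\<close>

definition is_minimum :: "real set \<Rightarrow> real \<Rightarrow> bool" where
  "is_minimum V m \<longleftrightarrow> m \<in> V \<and> (\<forall>v\<in>V. m \<le> v)"

definition is_maximum :: "real set \<Rightarrow> real \<Rightarrow> bool" where
  "is_maximum V m \<longleftrightarrow> m \<in> V \<and> (\<forall>v\<in>V. v \<le> m)"

definition maximin_solution ::
  "('x \<Rightarrow> 'y \<Rightarrow> real) \<Rightarrow> 'x set \<Rightarrow> 'y set \<Rightarrow> 'x \<Rightarrow> real \<Rightarrow> bool" where
  "maximin_solution f X Y x v \<longleftrightarrow>
     x \<in> X \<and> is_minimum (f x ` Y) v \<and> is_maximum {m. \<exists>x'\<in>X. is_minimum (f x' ` Y) m} v"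


definition induced_by ::
  "('s::finite, 'a::finite, 'm) mdp_scheme \<Rightarrow> (nat \<Rightarrow> 's \<Rightarrow> 'a \<Rightarrow> real) \<Rightarrow>
   (nat \<Rightarrow> 's \<Rightarrow> 'a pmf) \<Rightarrow> bool" where
  "induced_by M q \<pi> \<longleftrightarrow>
     (\<forall>h\<in>{1..horizon M}. \<forall>s a. (\<Sum>b\<in>UNIV. q h s b) > 0 \<longrightarrow>
        pmf (\<pi> h s) a = q h s a / (\<Sum>b\<in>UNIV. q h s b))"

text \<open>
  The law of one agent's state-action pair at time \<open>h + 1\<close>, given the pair \<open>z\<close> at time \<open>h\<close>
  (for \<open>h = 0\<close>: the law of the first pair; \<open>z\<close> is then ignored).
\<close>

definition agent_step ::
  "('s, 'a, 'm) mdp_scheme \<Rightarrow> (nat \<Rightarrow> 's \<Rightarrow> 'a pmf) \<Rightarrow> nat \<Rightarrow> 's \<times> 'a \<Rightarrow> ('s \<times> 'a) pmf" where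
  "agent_step M \<pi> h z = do {
     s \<leftarrow> (if h = 0 then return_pmf (initial M) else trans M h (fst z) (snd z));
     a \<leftarrow> \<pi> (Suc h) s;
     return_pmf (s, a)
   }"

text \<open>
  The law of the joint trajectory up to time \<open>n\<close>; a trajectory maps \<open>h \<in> {1..n}\<close> to
  \<open>((s1, a1), (s2, a2))\<close>.  At each time the two agents act and move independently.
\<close>

primrec joint_run ::
  "('s1, 'a1, 'm1) mdp_scheme \<Rightarrow> ('s2, 'a2, 'm2) mdp_scheme \<Rightarrow>
   (nat \<Rightarrow> 's1 \<Rightarrow> 'a1 pmf) \<Rightarrow> (nat \<Rightarrow> 's2 \<Rightarrow> 'a2 pmf) \<Rightarrow> nat \<Rightarrow>
   (nat \<Rightarrow> ('s1 \<times> 'a1) \<times> ('s2 \<times> 'a2)) pmf" where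
  "joint_run M1 M2 \<pi>1 \<pi>2 0 = return_pmf (\<lambda>_. undefined)"
| "joint_run M1 M2 \<pi>1 \<pi>2 (Suc h) = do {
     \<omega> \<leftarrow> joint_run M1 M2 \<pi>1 \<pi>2 h;
     z \<leftarrow> pair_pmf (agent_step M1 \<pi>1 h (fst (\<omega> h))) (agent_step M2 \<pi>2 h (snd (\<omega> h)));
     return_pmf (fun_upd \<omega> (Suc h) z)
   }"

definition expected_joint_reward ::
  "('s1, 'a1, 'm1) mdp_scheme \<Rightarrow> ('s2, 'a2, 'm2) mdp_scheme \<Rightarrow>
   (nat \<Rightarrow> 's1 \<Rightarrow> 'a1 pmf) \<Rightarrow> (nat \<Rightarrow> 's2 \<Rightarrow> 'a2 pmf) \<Rightarrow> nat \<Rightarrow>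
   (nat \<Rightarrow> 's1 \<Rightarrow> 's2 \<Rightarrow> 'a1 \<Rightarrow> 'a2 \<Rightarrow> real) \<Rightarrow> real" where
  "expected_joint_reward M1 M2 \<pi>1 \<pi>2 K r =
     measure_pmf.expectation (joint_run M1 M2 \<pi>1 \<pi>2 K)
       (\<lambda>\<omega>. \<Sum>h=1..K. case \<omega> h of ((s1, a1), (s2, a2)) \<Rightarrow> r h s1 s2 a1 a2)"

end

theory Submission
  imports Defs
begin

text \<open>
  Both \<open>v\<^sub>x\<close> and \<open>v\<^sub>y\<close> are minima of \<open>g\<close> over one argument, the other one being fixed at an
  optimal solution; as \<open>x\<close> and \<open>y\<close> are feasible, both are at most \<open>g x y\<close>.  An occupancy
  measure is the family of state-action marginals of any policy it induces, and the agents are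
  independent, so \<open>g x y\<close> is exactly the expected joint reward of the induced policies.
\<close>

text \<open>\<open>z0\<close> is the dummy pair at time 0. It is a parameter so that it can match a
  component of the \<open>undefined\<close> entry from which \<open>joint_run\<close>
  starts.\<close>

primrec agent_law ::
  "'s \<times> 'a \<Rightarrow> ('s, 'a, 'm) mdp_scheme \<Rightarrow> (nat \<Rightarrow> 's \<Rightarrow> 'a pmf) \<Rightarrow> nat \<Rightarrow> ('s \<times> 'a) pmf" where
  "agent_law z0 M \<pi> 0 = return_pmf z0"
| "agent_law z0 M \<pi> (Suc h) = agent_law z0 M \<pi> h \<bind> agent_step M \<pi> h"

text \<open>Independence survives a step in which each component moves on its own: the draw from
  \<open>B\<close> does not look at the outcome of \<open>f a\<close>, so the two draws
  commute.\<close>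

lemma pair_pmf_bind_pmf:
  "pair_pmf (A \<bind> f) (B \<bind> g) = pair_pmf A B \<bind> (\<lambda>z. pair_pmf (f (fst z)) (g (snd z)))"
proof -
  have "pair_pmf (A \<bind> f) (B \<bind> g) =
      A \<bind> (\<lambda>a. f a \<bind> (\<lambda>x. B \<bind> (\<lambda>b. g b \<bind> (\<lambda>y. return_pmf (x, y)))))"
    by (simp add: pair_pmf_def bind_assoc_pmf)
  also have "\<dots> = A \<bind> (\<lambda>a. B \<bind> (\<lambda>b. f a \<bind> (\<lambda>x. g b \<bind> (\<lambda>y. return_pmf (x, y)))))"
    by (subst (2) bind_commute_pmf) simp
  also have "\<dots> = pair_pmf A B \<bind> (\<lambda>z. pair_pmf (f (fst z)) (g (snd z)))"
    by (simp add: pair_pmf_def bind_assoc_pmf bind_return_pmf)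
  finally show ?thesis .
qed

text \<open>The run starts from an arbitrary pair at time \<open>0\<close>, which \<open>agent_step\<close> ignores.\<close>

lemma joint_run_last:
  assumes "undefined = (z1, z2)"
  shows "map_pmf (\<lambda>\<omega>. \<omega> n) (joint_run M1 M2 \<pi>1 \<pi>2 n) =
    pair_pmf (agent_law z1 M1 \<pi>1 n) (agent_law z2 M2 \<pi>2 n)"
proof (induction n)
  case 0
  with assms show ?case by simp
next
  case (Suc n)
  \<comment> \<open>The step reads only the latest entry of the trajectory, so the law of that entry
    evolves as a Markov chain.\<close>
  have "map_pmf (\<lambda>\<omega>. \<omega> (Suc n)) (joint_run M1 M2 \<pi>1 \<pi>2 (Suc n)) =
      map_pmf (\<lambda>\<omega>. \<omega> n) (joint_run M1 M2 \<pi>1 \<pi>2 n) \<bind>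
        (\<lambda>z. pair_pmf (agent_step M1 \<pi>1 n (fst z)) (agent_step M2 \<pi>2 n (snd z)))"
    by (simp add: map_bind_pmf bind_map_pmf bind_return_pmf')
  then show ?case
    by (simp add: Suc.IH pair_pmf_bind_pmf)
qed

text \<open>Each step after time \<open>h\<close> writes only a later entry, so the marginal at
  \<open>h\<close> is frozen once it has been drawn.\<close>

lemma joint_run_marginal:
  assumes z: "undefined = (z1, z2)" and "h \<le> n"
  shows "map_pmf (\<lambda>\<omega>. \<omega> h) (joint_run M1 M2 \<pi>1 \<pi>2 n) =
    pair_pmf (agent_law z1 M1 \<pi>1 h) (agent_law z2 M2 \<pi>2 h)"
  using assms(2)
proof (induction n rule: dec_induct)
  case base
  from z show ?case by (rule joint_run_last)
next
  case (step m)
  then have "map_pmf (\<lambda>\<omega>. \<omega> h) (joint_run M1 M2 \<pi>1 \<pi>2 (Suc m)) =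
      map_pmf (\<lambda>\<omega>. \<omega> h) (joint_run M1 M2 \<pi>1 \<pi>2 m)"
    by (simp add: map_pmf_def bind_assoc_pmf bind_return_pmf)
  with step.IH show ?case by simp
qed

text \<open>The trajectory type is infinite, but every step has finitely many outcomes; the finite
  support makes all rewards integrable.\<close>

lemma finite_set_pmf_joint_run:
  fixes M1 :: "('s1::finite, 'a1::finite, 'm1) mdp_scheme"
    and M2 :: "('s2::finite, 'a2::finite, 'm2) mdp_scheme"
  shows "finite (set_pmf (joint_run M1 M2 \<pi>1 \<pi>2 n))"
  by (induction n) simp_all

lemma pmf_agent_step:
  fixes M :: "('s::finite, 'a::finite, 'm) mdp_scheme"
  shows "pmf (agent_step M \<pi> h z) (s, a) =
    pmf (if h = 0 then return_pmf (initial M) else trans M h (fst z) (snd z)) s * pmf (\<pi> (Suc h) s) a"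
proof -
  \<comment> \<open>The pair records the state, so only \<open>s' = s\<close> contributes to the
    mixture over states.\<close>
  have "pmf (\<pi> (Suc h) s' \<bind> (\<lambda>a'. return_pmf (s', a'))) (s, a) =
      indicator {s} s' * pmf (\<pi> (Suc h) s) a" for s'
  proof (cases "s' = s")
    case True
    have "inj (Pair s :: 'a \<Rightarrow> _)" by (auto intro: injI)
    from pmf_map_inj'[OF this, of "\<pi> (Suc h) s" a] True show ?thesis
      by (simp add: map_pmf_def)
  qed (auto simp: pmf_eq_0_set_pmf)
  then show ?thesis
    unfolding agent_step_def by (simp add: pmf_bind measure_pmf_single)
qed

text \<open>Where the state has mass 0 the policy is arbitrary, but nonnegativity forces
  \<open>q h s a = 0\<close>, so multiplying out the quotient is safe everywhere.\<close>

lemma induced_by_disintegration: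
  fixes M :: "('s::finite, 'a::finite, 'm) mdp_scheme"
  assumes q: "occupancy_measure M q" and ind: "induced_by M q \<pi>" and h: "h \<in> {1..horizon M}"
  shows "(\<Sum>b\<in>UNIV. q h s b) * pmf (\<pi> h s) a = q h s a"
proof -
  have nonneg: "q h s b \<ge> 0" for b
    using q h by (auto simp: occupancy_measure_def)
  show ?thesis
  proof (cases "(\<Sum>b\<in>UNIV. q h s b) = 0")
    case True
    then have "q h s a = 0"
      using sum_nonneg_eq_0_iff[of UNIV "q h s"] nonneg by simp
    with True show ?thesis by simp
  next
    case False
    then have "(\<Sum>b\<in>UNIV. q h s b) > 0"
      using sum_nonneg[of UNIV "q h s"] nonneg by (simp add: order_less_le)
    then show ?thesis
      using ind h False by (simp add: induced_by_def)
  qed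
qed

text \<open>The flow constraints on \<open>q\<close> are the forward equations of the chain driven
  by \<open>\<pi>\<close>. The induction starts at 1, time 0 being the dummy.\<close>

lemma pmf_agent_law_induced:
  fixes M :: "('s::finite, 'a::finite, 'm) mdp_scheme"
  assumes q: "occupancy_measure M q" and ind: "induced_by M q \<pi>"
    and "1 \<le> h" and "h \<le> horizon M"
  shows "pmf (agent_law z0 M \<pi> h) (s, a) = q h s a"
  using assms(3,4)
proof (induction h arbitrary: s a rule: nat_induct_at_least)
  case base
  have "pmf (return_pmf (initial M)) s = (\<Sum>b\<in>UNIV. q 1 s b)"
    using q by (simp add: occupancy_measure_def indicator_def)
  with base show ?case
    using induced_by_disintegration[OF q ind, of 1 s a]
    by (simp add: bind_return_pmf pmf_agent_step del: pmf_return)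
next
  case (Suc h)
  have "pmf (agent_law z0 M \<pi> (Suc h)) (s, a) =
      (\<Sum>z\<in>UNIV. pmf (agent_step M \<pi> h z) (s, a) * pmf (agent_law z0 M \<pi> h) z)"
    unfolding agent_law.simps pmf_bind by (rule integral_measure_pmf_real) auto
  \<comment> \<open>Since \<open>h\<close> is at least 1, \<open>agent_step\<close> takes its
    transition branch instead of restarting at \<open>initial M\<close>.\<close>
  also have "\<dots> = (\<Sum>z\<in>UNIV. case z of (s', a') \<Rightarrow>
      pmf (trans M h s' a') s * q h s' a' * pmf (\<pi> (Suc h) s) a)"
    using Suc by (intro sum.cong) (auto simp: pmf_agent_step)
  also have "\<dots> = (\<Sum>s'\<in>UNIV. \<Sum>a'\<in>UNIV. pmf (trans M h s' a') s * q h s' a') * pmf (\<pi> (Suc h) s) a"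
    by (simp add: sum_distrib_right sum.cartesian_product case_prod_unfold)
  also have "\<dots> = (\<Sum>b\<in>UNIV. q (Suc h) s b) * pmf (\<pi> (Suc h) s) a"
    using q Suc by (simp add: occupancy_measure_def)
  also have "\<dots> = q (Suc h) s a"
    using induced_by_disintegration[OF q ind] Suc by simp
  finally show ?case .
qed

text \<open>The total reward is additive over time, so by linearity only the marginals at single
  times matter, and these are products of the agents' marginals.\<close>

lemma expected_joint_reward_induced:
  fixes M1 :: "('s1::finite, 'a1::finite, 'm1) mdp_scheme"
    and M2 :: "('s2::finite, 'a2::finite, 'm2) mdp_scheme"
  assumes x: "occupancy_measure M1 x" "induced_by M1 x \<pi>1" "K \<le> horizon M1"
    and y: "occupancy_measure M2 y" "induced_by M2 y \<pi>2" "K \<le> horizon M2"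
  shows "expected_joint_reward M1 M2 \<pi>1 \<pi>2 K r = occupancy_value K r x y"
proof -
  obtain z1 z2 where z: "(undefined :: ('s1 \<times> 'a1) \<times> ('s2 \<times> 'a2)) = (z1, z2)"
    by (rule prod.exhaust)
  let ?J = "joint_run M1 M2 \<pi>1 \<pi>2 K"
  let ?f = "\<lambda>h z. case z of ((s1, a1), (s2, a2)) \<Rightarrow> r h s1 s2 a1 a2"
  have "expected_joint_reward M1 M2 \<pi>1 \<pi>2 K r =
      (\<Sum>h=1..K. measure_pmf.expectation ?J (\<lambda>\<omega>. ?f h (\<omega> h)))"
    unfolding expected_joint_reward_def
    by (intro Bochner_Integration.integral_sum integrable_measure_pmf_finite finite_set_pmf_joint_run)
  also have "\<dots> = occupancy_value K r x y"
    unfolding occupancy_value_def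
  proof (rule sum.cong)
    fix h assume h: "h \<in> {1..K}"
    let ?P = "pair_pmf (agent_law z1 M1 \<pi>1 h) (agent_law z2 M2 \<pi>2 h)"
    have "measure_pmf.expectation ?J (\<lambda>\<omega>. ?f h (\<omega> h)) =
        measure_pmf.expectation (map_pmf (\<lambda>\<omega>. \<omega> h) ?J) (?f h)"
      by simp
    also have "\<dots> = measure_pmf.expectation ?P (?f h)"
      using h by (subst joint_run_marginal[OF z]) auto
    also have "\<dots> = (\<Sum>z\<in>UNIV. ?f h z * pmf ?P z)"
      by (rule integral_measure_pmf_real) auto
    \<comment> \<open>Writing the index set as nested products lets the sum split into four.\<close>
    also have "\<dots> = (\<Sum>z\<in>(UNIV \<times> UNIV) \<times> (UNIV \<times> UNIV). case z of ((s1, a1), (s2, a2)) \<Rightarrow>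
        r h s1 s2 a1 a2 * x h s1 a1 * y h s2 a2)"
      using h x y by (intro sum.cong) (auto simp: pmf_pair pmf_agent_law_induced)
    also have "\<dots> = (\<Sum>s1\<in>UNIV. \<Sum>a1\<in>UNIV. \<Sum>s2\<in>UNIV. \<Sum>a2\<in>UNIV.
        r h s1 s2 a1 a2 * x h s1 a1 * y h s2 a2)"
      by (simp only: sum.cartesian_product' prod.case)
    finally show "measure_pmf.expectation ?J (\<lambda>\<omega>. ?f h (\<omega> h)) = \<dots>" .
  qed simp
  finally show ?thesis .
qed

theorem theorem3:
  fixes M1 :: "('s1::finite, 'a1::finite, 'p) lmdp"
    and M2 :: "('s2::finite, 'a2::finite, 'p) lmdp"
    and \<A>1 :: "('q1::finite, 'p) dfa"
    and \<A>2 :: "('q2::finite, 'p) dfa"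
    and \<phi>1 \<phi>2 :: "'p ltlf"
    and H :: nat
    and rJ :: "nat \<Rightarrow> 's1 \<times> 's2 \<Rightarrow> 'a1 \<times> 'a2 \<Rightarrow> real"
    and \<delta>1 \<delta>2 :: real
    and N1 :: "('s1 \<times> 'q1, 'a1) cmdp"
    and N2 :: "('s2 \<times> 'q2, 'a2) cmdp"
    and r :: "nat \<Rightarrow> 's1 \<times> 'q1 \<Rightarrow> 's2 \<times> 'q2 \<Rightarrow> 'a1 \<Rightarrow> 'a2 \<Rightarrow> real"
    and X :: "(nat \<Rightarrow> 's1 \<times> 'q1 \<Rightarrow> 'a1 \<Rightarrow> real) set"
    and Y :: "(nat \<Rightarrow> 's2 \<times> 'q2 \<Rightarrow> 'a2 \<Rightarrow> real) set"
    and g :: "(nat \<Rightarrow> 's1 \<times> 'q1 \<Rightarrow> 'a1 \<Rightarrow> real) \<Rightarrow> (nat \<Rightarrow> 's2 \<times> 'q2 \<Rightarrow> 'a2 \<Rightarrow> real) \<Rightarrow> real"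
    and x :: "nat \<Rightarrow> 's1 \<times> 'q1 \<Rightarrow> 'a1 \<Rightarrow> real"
    and y :: "nat \<Rightarrow> 's2 \<times> 'q2 \<Rightarrow> 'a2 \<Rightarrow> real"
    and vx vy :: real
    and \<pi>1 :: "nat \<Rightarrow> 's1 \<times> 'q1 \<Rightarrow> 'a1 pmf"
    and \<pi>2 :: "nat \<Rightarrow> 's2 \<times> 'q2 \<Rightarrow> 'a2 pmf"
  assumes "labeled_mdp M1" and "labeled_mdp M2"
    and "horizon M1 = H" and "horizon M2 = H"
    and "props M1 \<inter> props M2 = {}"
    and "dfa_equivalent (props M1) \<A>1 \<phi>1" and "dfa_equivalent (props M2) \<A>2 \<phi>2"
    and "N1 = product_mdp M1 \<A>1" and "N2 = product_mdp M2 \<A>2"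
    and "r = product_reward H rJ"
    and "X = feasible_occupancies N1 \<delta>1" and "Y = feasible_occupancies N2 \<delta>2"
    and "g = occupancy_value (H + 1) r"
    and "maximin_solution g X Y x vx" and "induced_by N1 x \<pi>1"
    and "maximin_solution (\<lambda>y x. g x y) Y X y vy" and "induced_by N2 y \<pi>2"
  shows "vx \<le> expected_joint_reward N1 N2 \<pi>1 \<pi>2 (H + 1) r \<and>
         vy \<le> expected_joint_reward N1 N2 \<pi>1 \<pi>2 (H + 1) r"
proof -
  have x: "x \<in> X" and vx: "is_minimum (g x ` Y) vx"
    and y: "y \<in> Y" and vy: "is_minimum ((\<lambda>x. g x y) ` X) vy"
    using assms(14,16) by (auto simp: maximin_solution_def)
  \<comment> \<open>Both products have horizon \<open>H + 1\<close>, so the identity covers every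
    time, including the last one, where \<open>r\<close> vanishes.\<close>
  have "expected_joint_reward N1 N2 \<pi>1 \<pi>2 (H + 1) r = g x y"
    unfolding \<open>g = occupancy_value (H + 1) r\<close>
    using x y assms(3,4,8,9,11,12,15,17)
    by (intro expected_joint_reward_induced) (auto simp: feasible_occupancies_def product_mdp_def)
  with x y vx vy show ?thesis
    by (auto simp: is_minimum_def)
qed

end
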